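(* Let $c\in\mathbb{R}$, let $z:(0,\infty)\to\mathbb{R}$ be smooth, and let $M_c^2$ be the helicoidal surface $\mathbf{R}(u,t)=(u\cos t,\,u\sin t,\,z(u)+ct)$, $u>0$, $t\in\mathbb{R}$, in simply isotropic space. Suppose its minimal Gauss map $\mathbf{N}_m=(N_m^1,N_m^2,N_m^3)$ is of coordinate finite-type, i.e. there are $\lambda_1,\lambda_2\in\mathbb{R}$ with $-\Delta\mathbf{N}_m=(\lambda_1N_m^1,\lambda_2N_m^2,0)$. Then $M_c^2$ belongs to one of the following families: (1) If $c\neq0$, then $\lambda_1=\lambda_2=0$ and $z(u)=z_0+z_1u^2+z_2\ln u$, where $z_0,z_1,z_2$ are constants. (2) If $c=0$, one of the following three cases holds: (a) If $\lambda_1=\lambda_2=0$, then $z(u)=z_0+z_1u^2+z_2\ln u$, where $z_0,z_1,z_2$ are constants. (b) If $\lambda_1=\lambda_2=\lambda\neq0$, then $$z(u)=\begin{cases} z_0+z_1J_0(\sqrt{\lambda}\,u)+z_2Y_0(\sqrt{\lambda}\,u) & \text{if }\lambda>0,\\ z_0+z_1I_0(\sqrt{-\lambda}\,u)+z_2K_0(\sqrt{-\lambda}\,u) & \text{if }\lambda<0,\end{cases}$$ where $z_0,z_1,z_2$ are constants. (c) If $\lambda_1\neq\lambda_2$, then $z(u)$ is a constant function.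
   Context: Simply isotropic space $\mathbb{I}^3$ is $\mathbb{R}^3$ with the degenerate inner product $\langle X,Y\rangle=x_1y_1+x_2y_2$. A surface $\mathbf{x}(u^1,u^2)$ is admissible if the induced metric $g_{ij}=\langle\partial_i\mathbf{x},\partial_j\mathbf{x}\rangle$ has rank 2. Its minimal normal (minimal Gauss map) is $\mathbf{N}_m=(\mathbf{x}_1\times\mathbf{x}_2)/X_{12}$, where $\times$ is the Euclidean cross product, $\mathbf{x}_i=\partial_i\mathbf{x}$, and $X_{12}=\det\begin{pmatrix} x^1_1 & x^2_1 \\ x^1_2 & x^2_2 \end{pmatrix}$ is the third coordinate of $\mathbf{x}_1\times\mathbf{x}_2$ (with $x^i_k=\partial x^i/\partial u^k$). $\Delta$ is the Laplace-Beltrami operator of $g_{ij}$, acting coordinatewise on vector-valued maps. For the helicoidal surface $\mathbf{R}$ one has $$\mathbf{N}_m=\Big(\tfrac{c}{u}\sin t-z'\cos t,\;-\tfrac{c}{u}\cos t-z'\sin t,\;1\Big),\qquad \Delta=\frac{\partial^2}{\partial u^2}+\frac1u\frac{\partial}{\partial u}+\frac1{u^2}\frac{\partial^2}{\partial t^2}.$$ $J_0,Y_0$ are the zero order Bessel functions of the first and second kind, and $I_0,K_0$ are the zero order modified Bessel functions of the first and second kind (called Bessel functions of the third and fourth type in the source). *)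

theory Defs
  imports "HOL-Analysis.Analysis"
begin

definition smooth_real_on :: "real set \<Rightarrow> (real \<Rightarrow> real) \<Rightarrow> bool" where
  "smooth_real_on S f \<longleftrightarrow> (\<forall>n. \<forall>x\<in>S. (deriv ^^ n) f differentiable (at x))"

definition partial :: "2 \<Rightarrow> (real^2 \<Rightarrow> 'a::real_normed_vector) \<Rightarrow> real^2 \<Rightarrow> 'a" where
  "partial i f p = vector_derivative (\<lambda>h. f (p + h *\<^sub>R axis i 1)) (at 0)"

text \<open>Simply isotropic space is \<^typ>\<open>real^3\<close> with the following degenerate inner product.\<close>

definition iso_inner :: "real^3 \<Rightarrow> real^3 \<Rightarrow> real" where
  "iso_inner X Y = X$1 * Y$1 + X$2 * Y$2"

definition induced_metric :: "(real^2 \<Rightarrow> real^3) \<Rightarrow> real^2 \<Rightarrow> real^2^2" where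
  "induced_metric x p = (\<chi> i j. iso_inner (partial i x p) (partial j x p))"

definition minimal_normal :: "(real^2 \<Rightarrow> real^3) \<Rightarrow> real^2 \<Rightarrow> real^3" where
  "minimal_normal x p =
    (let x1 = partial 1 x p; x2 = partial 2 x p;
         X12 = det (vector [vector [x1$1, x1$2], vector [x2$1, x2$2]] :: real^2^2)
     in (1 / X12) *\<^sub>R cross3 x1 x2)"

text \<open>Here \<open>matrix_inv\<close> supplies the contravariant components of the metric, so the definition
  is meaningful where the metric has rank 2.\<close>

definition laplace_beltrami :: "(real^2 \<Rightarrow> real^2^2) \<Rightarrow> (real^2 \<Rightarrow> real) \<Rightarrow> real^2 \<Rightarrow> real" where
  "laplace_beltrami g f p =
    (1 / sqrt (det (g p))) *
    (\<Sum>i\<in>UNIV. partial i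
       (\<lambda>q. sqrt (det (g q)) * (\<Sum>j\<in>UNIV. matrix_inv (g q) $ i $ j * partial j f q)) p)"

definition laplace_beltrami_vec ::
    "(real^2 \<Rightarrow> real^2^2) \<Rightarrow> (real^2 \<Rightarrow> real^'n) \<Rightarrow> real^2 \<Rightarrow> real^'n" where
  "laplace_beltrami_vec g F p = (\<chi> k. laplace_beltrami g (\<lambda>q. F q $ k) p)"

text \<open>The parameters \<open>(u, t)\<close> are the components \<open>p$1\<close>, \<open>p$2\<close>; only \<open>u > 0\<close> is of interest.\<close>

definition helicoidal :: "real \<Rightarrow> (real \<Rightarrow> real) \<Rightarrow> real^2 \<Rightarrow> real^3" where
  "helicoidal c z p = vector [p$1 * cos (p$2), p$1 * sin (p$2), z (p$1) + c * p$2]"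

text \<open>Bessel functions and modified Bessel functions of order zero, by their standard series
  (DLMF 10.2.2, 10.8.2, 10.25.2, 10.31.2); those of the second kind are meant for \<open>x > 0\<close>.\<close>

definition bessel_J0 :: "real \<Rightarrow> real" where
  "bessel_J0 x = (\<Sum>k. (-1)^k * (x/2)^(2*k) / (fact k)^2)"

definition bessel_Y0 :: "real \<Rightarrow> real" where
  "bessel_Y0 x = 2/pi * ((ln (x/2) + euler_mascheroni) * bessel_J0 x
     - (\<Sum>k. (-1)^k * harm k * (x/2)^(2*k) / (fact k)^2))"

definition bessel_I0 :: "real \<Rightarrow> real" where
  "bessel_I0 x = (\<Sum>k. (x/2)^(2*k) / (fact k)^2)"

definition bessel_K0 :: "real \<Rightarrow> real" where
  "bessel_K0 x = - (ln (x/2) + euler_mascheroni) * bessel_I0 x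
     + (\<Sum>k. harm k * (x/2)^(2*k) / (fact k)^2)"

end

theory Submission
  imports Defs
begin

text \<open>
  The metric of \<open>R(u, t) = (u cos t, u sin t, z(u) + c t)\<close> is \<open>du\<^sup>2 + u\<^sup>2 dt\<^sup>2\<close>: it is flat and depends
  neither on the profile \<open>z\<close> nor on the pitch \<open>c\<close>, and \<open>\<Delta>\<close> is the Laplacian of the plane in polar
  coordinates (\<open>induced_metric_helicoidal\<close>, \<open>laplace_beltrami_polar\<close>). Write \<open>w = z'\<close>. The terms
  \<open>(c/u) sin t\<close> and \<open>(c/u) cos t\<close> of the minimal normal are harmonic, so only \<open>w\<close> survives in
  \<open>\<Delta>N\<close>, with the operator \<open>L w = w'' + w'/u - w/u\<^sup>2\<close>. In the first coordinate the
  eigenvalue equation reads \<open>L w cos t = \<lambda>\<^sub>1 ((c/u) sin t - w cos t)\<close>, and similarly in the second.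
  Since \<open>cos\<close> and \<open>sin\<close> are linearly independent, this says exactly that
  \<open>\<lambda>\<^sub>1 c = \<lambda>\<^sub>2 c = 0\<close> and \<open>L w = -\<lambda>\<^sub>1 w = -\<lambda>\<^sub>2 w\<close> (\<open>coordinate_finite_type_helicoidal\<close>).

  If \<open>\<lambda>\<^sub>1 \<noteq> \<lambda>\<^sub>2\<close>, then \<open>w = 0\<close>. Otherwise let \<open>\<lambda>\<close> be the common value. As \<open>L w\<close> is the derivative of
  \<open>w' + w/u\<close>, the quantity \<open>z'' + z'/u + \<lambda> z\<close> is a constant \<open>k\<close> (\<open>profile_first_integral\<close>). For
  \<open>\<lambda> = 0\<close> two elementary integrations give \<open>z\<close>. For \<open>\<lambda> \<noteq> 0\<close>, the function \<open>y = z - k/\<lambda>\<close> satisfies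
  \<open>(u y')' = -\<lambda> u y\<close>, Bessel's equation of order zero in the variable \<open>sqrt \<bar>\<lambda>\<bar> u\<close>
  (the modified one if \<open>\<lambda> < 0\<close>).

  It remains to know that the two Bessel functions span the solutions of this equation. Both signs
  of \<open>\<lambda>\<close> are treated at once: with \<open>f(s) = \<Sum> s\<^sup>k/k!\<^sup>2\<close> the functions \<open>J\<^sub>0\<close> and \<open>I\<^sub>0\<close> are
  \<open>f(-\<lambda>u\<^sup>2/4)\<close>, and \<open>Y\<^sub>0\<close> and \<open>K\<^sub>0\<close> are, up to a nonzero factor, the logarithmic companion of this function
  (\<open>bessel_JY_eq\<close>, \<open>bessel_IK_eq\<close>). The quantity \<open>u (f g' - g f')\<close> is constant along any two
  solutions \<open>f\<close> and \<open>g\<close>; for the fundamental pair its limit at \<open>0\<close> is \<open>1\<close>, and then any solution is recovered from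
  its Wronskians with the pair (\<open>bessel_wronskian_eq_1\<close>, \<open>bessel_solution_span\<close>).
\<close>

section \<open>The minimal Gauss map of a helicoidal surface\<close>

text \<open>Functions on the parameter plane are handled only through their values on the half-plane
  \<open>u > 0\<close>. This suffices because the half-plane is open, so that moving \<open>u\<close> a little does not leave it.\<close>

lemma partial_1_eq:
  assumes u: "p$1 > 0" and f: "\<And>q::real^2. q$1 > 0 \<Longrightarrow> f q = \<phi> (q$1) (q$2)"
    and D: "((\<lambda>x. \<phi> x (p$2)) has_vector_derivative D) (at (p$1))"
  shows "partial 1 f p = D"
proof -
  have D0: "((\<lambda>h. \<phi> (p$1 + h) (p$2)) has_vector_derivative D) (at 0)"
    using vector_diff_chain_at[OF has_vector_derivative_add[OF
        has_vector_derivative_const has_vector_derivative_id], of "\<lambda>x. \<phi> x (p$2)" D "p$1" 0] D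
    by (simp add: o_def)
  have "((\<lambda>h. f (p + h *\<^sub>R axis 1 1)) has_vector_derivative D) (at 0)"
  proof (rule has_vector_derivative_transform_within_open[OF D0])
    show "open {-(p$1)<..}" "0 \<in> {-(p$1)<..}" using u by auto
    fix h assume "h \<in> {-(p$1)<..}"
    then have h: "(p + h *\<^sub>R axis 1 1)$1 > 0" by simp
    show "\<phi> (p$1 + h) (p$2) = f (p + h *\<^sub>R axis 1 1)"
      using f[OF h] by (simp add: axis_def)
  qed
  then show ?thesis by (simp add: partial_def vector_derivative_at)
qed

lemma partial_2_eq:
  assumes u: "p$1 > 0" and f: "\<And>q::real^2. q$1 > 0 \<Longrightarrow> f q = \<phi> (q$1) (q$2)"
    and D: "((\<lambda>t. \<phi> (p$1) t) has_vector_derivative D) (at (p$2))"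
  shows "partial 2 f p = D"
proof -
  have D0: "((\<lambda>h. \<phi> (p$1) (p$2 + h)) has_vector_derivative D) (at 0)"
    using vector_diff_chain_at[OF has_vector_derivative_add[OF
        has_vector_derivative_const has_vector_derivative_id], of "\<phi> (p$1)" D "p$2" 0] D
    by (simp add: o_def)
  have "(\<lambda>h. f (p + h *\<^sub>R axis 2 1)) = (\<lambda>h. \<phi> (p$1) (p$2 + h))"
    using u f by (auto simp: axis_def fun_eq_iff)
  with D0 show ?thesis by (simp add: partial_def vector_derivative_at)
qed

lemma has_vector_derivative_vector_3:
  fixes a b c :: "real \<Rightarrow> real"
  assumes "(a has_real_derivative a') (at x)" "(b has_real_derivative b') (at x)"
    "(c has_real_derivative c') (at x)"
  shows "((\<lambda>x. vector [a x, b x, c x] :: real^3) has_vector_derivative vector [a', b', c']) (at x)"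
proof -
  have v: "(vector [r, s, t] :: real^3) = r *\<^sub>R axis 1 1 + s *\<^sub>R axis 2 1 + t *\<^sub>R axis 3 1" for r s t
    by (simp add: vec_eq_iff forall_3 axis_def)
  show ?thesis
    unfolding v using assms
    by (auto intro!: derivative_eq_intros)
qed

lemma matrix_inv_eqI:
  fixes A B :: "real^'n^'n"
  assumes "A ** B = mat 1" "B ** A = mat 1"
  shows "matrix_inv A = B"
proof -
  have "A ** matrix_inv A = mat 1 \<and> matrix_inv A ** A = mat 1"
    unfolding matrix_inv_def by (rule someI[of _ B]) (use assms in simp)
  then show ?thesis
    by (metis assms(2) matrix_mul_assoc matrix_mul_lid matrix_mul_rid)
qed

lemma polar_metric_det_inv:
  fixes u :: real
  assumes "u > 0"
  defines "g \<equiv> vector [vector [1, 0], vector [0, u^2]] :: real^2^2"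
  shows "sqrt (det g) = u"
    and "matrix_inv g = vector [vector [1, 0], vector [0, 1 / u^2]]"
proof -
  show "sqrt (det g) = u" using assms by (simp add: g_def det_2)
  show "matrix_inv g = vector [vector [1, 0], vector [0, 1 / u^2]]"
    using assms by (intro matrix_inv_eqI)
      (simp_all add: g_def vec_eq_iff forall_2 matrix_matrix_mult_def sum_2 mat_def)
qed

text \<open>The polar form \<open>\<phi>\<^sub>u\<^sub>u + \<phi>\<^sub>u/u + \<phi>\<^sub>t\<^sub>t/u\<^sup>2\<close> of the Laplacian: the area density is \<open>u\<close>, and the inverse
  metric is \<open>diag(1, 1/u\<^sup>2)\<close>, so the divergence form is \<open>((u \<phi>\<^sub>u)\<^sub>u + (\<phi>\<^sub>t/u)\<^sub>t)/u\<close>.\<close>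

lemma laplace_beltrami_polar:
  fixes f :: "real^2 \<Rightarrow> real" and \<phi> \<phi>\<^sub>u \<phi>\<^sub>u\<^sub>u \<phi>\<^sub>t \<phi>\<^sub>t\<^sub>t :: "real \<Rightarrow> real \<Rightarrow> real"
  assumes p: "p$1 > 0"
    and g: "\<And>q. q$1 > 0 \<Longrightarrow> g q = vector [vector [1, 0], vector [0, (q$1)^2]]"
    and f: "\<And>q. q$1 > 0 \<Longrightarrow> f q = \<phi> (q$1) (q$2)"
    and u: "\<And>u t. u > 0 \<Longrightarrow> ((\<lambda>x. \<phi> x t) has_real_derivative \<phi>\<^sub>u u t) (at u)"
    and uu: "\<And>u t. u > 0 \<Longrightarrow> ((\<lambda>x. \<phi>\<^sub>u x t) has_real_derivative \<phi>\<^sub>u\<^sub>u u t) (at u)"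
    and t: "\<And>u t. u > 0 \<Longrightarrow> (\<phi> u has_real_derivative \<phi>\<^sub>t u t) (at t)"
    and tt: "\<And>u t. u > 0 \<Longrightarrow> (\<phi>\<^sub>t u has_real_derivative \<phi>\<^sub>t\<^sub>t u t) (at t)"
  shows "laplace_beltrami g f p =
    \<phi>\<^sub>u\<^sub>u (p$1) (p$2) + \<phi>\<^sub>u (p$1) (p$2) / p$1 + \<phi>\<^sub>t\<^sub>t (p$1) (p$2) / (p$1)^2"
proof -
  have f1: "partial 1 f q = \<phi>\<^sub>u (q$1) (q$2)" if "q$1 > 0" for q
    using that u by (intro partial_1_eq[where \<phi> = \<phi>, OF that f])
      (auto simp: has_real_derivative_iff_has_vector_derivative)
  have f2: "partial 2 f q = \<phi>\<^sub>t (q$1) (q$2)" if "q$1 > 0" for q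
    using that t by (intro partial_2_eq[where \<phi> = \<phi>, OF that f])
      (auto simp: has_real_derivative_iff_has_vector_derivative)
  have 1: "partial 1 (\<lambda>q. sqrt (det (g q)) * (\<Sum>j\<in>UNIV. matrix_inv (g q) $ 1 $ j * partial j f q)) p
      = \<phi>\<^sub>u (p$1) (p$2) + p$1 * \<phi>\<^sub>u\<^sub>u (p$1) (p$2)"
  proof (rule partial_1_eq[OF p, where \<phi> = "\<lambda>u t. u * \<phi>\<^sub>u u t"])
    show "((\<lambda>x. x * \<phi>\<^sub>u x (p$2)) has_vector_derivative \<phi>\<^sub>u (p$1) (p$2) + p$1 * \<phi>\<^sub>u\<^sub>u (p$1) (p$2)) (at (p$1))"
      unfolding has_real_derivative_iff_has_vector_derivative[symmetric]
      using uu[OF p] by (auto intro!: derivative_eq_intros)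
  qed (simp add: g polar_metric_det_inv sum_2 f1 f2)
  have 2: "partial 2 (\<lambda>q. sqrt (det (g q)) * (\<Sum>j\<in>UNIV. matrix_inv (g q) $ 2 $ j * partial j f q)) p
      = \<phi>\<^sub>t\<^sub>t (p$1) (p$2) / p$1"
  proof (rule partial_2_eq[OF p, where \<phi> = "\<lambda>u t. \<phi>\<^sub>t u t / u"])
    show "((\<lambda>t. \<phi>\<^sub>t (p$1) t / p$1) has_vector_derivative \<phi>\<^sub>t\<^sub>t (p$1) (p$2) / p$1) (at (p$2))"
      unfolding has_real_derivative_iff_has_vector_derivative[symmetric]
      using tt[OF p] p by (auto intro!: derivative_eq_intros)
  qed (simp add: g polar_metric_det_inv sum_2 f1 f2, simp add: power2_eq_square)
  show ?thesis
    unfolding laplace_beltrami_def sum_2 1[unfolded sum_2] 2[unfolded sum_2] g[OF p]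
      polar_metric_det_inv(1)[OF p]
    using p by (simp add: field_simps power2_eq_square)
qed

lemma partial_helicoidal:
  assumes "p$1 > 0" and z: "\<And>u. u > 0 \<Longrightarrow> (z has_real_derivative w u) (at u)"
  shows "partial 1 (helicoidal c z) p = vector [cos (p$2), sin (p$2), w (p$1)]"
    and "partial 2 (helicoidal c z) p = vector [- p$1 * sin (p$2), p$1 * cos (p$2), c]"
  using assms
  by (auto intro!: partial_1_eq[OF assms(1), where \<phi> = "\<lambda>u t. vector [u * cos t, u * sin t, z u + c * t]"]
      partial_2_eq[OF assms(1), where \<phi> = "\<lambda>u t. vector [u * cos t, u * sin t, z u + c * t]"]
      has_vector_derivative_vector_3 derivative_eq_intros simp: helicoidal_def)

text \<open>The degenerate inner product does not see the third coordinate, so the helicoidal surface is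
  locally isometric to the punctured plane in polar coordinates, whatever \<open>c\<close> and \<open>z\<close> are.\<close>

lemma induced_metric_helicoidal:
  assumes "p$1 > 0" and "\<And>u. u > 0 \<Longrightarrow> (z has_real_derivative w u) (at u)"
  shows "induced_metric (helicoidal c z) p = vector [vector [1, 0], vector [0, (p$1)^2]]"
proof -
  have "x * cos t * (x * cos t) + x * sin t * (x * sin t) = x^2" for x t :: real
    using sin_cos_squared_add[of t] by algebra
  with partial_helicoidal[OF assms, of c] show ?thesis
    by (simp add: induced_metric_def iso_inner_def vec_eq_iff forall_2)
qed

lemma minimal_normal_helicoidal:
  assumes "p$1 > 0" and "\<And>u. u > 0 \<Longrightarrow> (z has_real_derivative w u) (at u)"
  shows "minimal_normal (helicoidal c z) p =
    vector [c / p$1 * sin (p$2) - w (p$1) * cos (p$2), - c / p$1 * cos (p$2) - w (p$1) * sin (p$2), 1]"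
proof -
  have "x * cos t * cos t + x * sin t * sin t = x" for x t :: real
    by (metis distrib_left mult.assoc mult.right_neutral power2_eq_square sin_cos_squared_add2)
  then show ?thesis
    using partial_helicoidal[OF assms] assms(1)
    by (simp add: minimal_normal_def Let_def det_2 cross3_def vec_eq_iff forall_3 field_simps)
qed

text \<open>The pitch \<open>c\<close> has disappeared from the result because \<open>sin t / u\<close> and \<open>cos t / u\<close> are harmonic in the
  punctured plane: for \<open>f = 1/u\<close> one has \<open>f'' + f'/u - f/u\<^sup>2 = 0\<close>.\<close>

lemma laplace_minimal_normal:
  fixes c :: real and z w w' w'' :: "real \<Rightarrow> real" and p :: "real^2"
  assumes p: "p$1 > 0"
    and w: "\<And>u. u > 0 \<Longrightarrow> (z has_real_derivative w u) (at u)"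
    and w1: "\<And>u. u > 0 \<Longrightarrow> (w has_real_derivative w' u) (at u)"
    and w2: "\<And>u. u > 0 \<Longrightarrow> (w' has_real_derivative w'' u) (at u)"
  defines "L \<equiv> \<lambda>u. w'' u + w' u / u - w u / u^2"
  defines "\<Delta> \<equiv> laplace_beltrami_vec (induced_metric (helicoidal c z)) (minimal_normal (helicoidal c z)) p"
  shows "\<Delta> $ 1 = - L (p$1) * cos (p$2)" and "\<Delta> $ 2 = - L (p$1) * sin (p$2)"
proof -
  note g = induced_metric_helicoidal[OF _ w]
  note N = minimal_normal_helicoidal[OF _ w]
  have \<Delta>1: "\<Delta> $ 1 =
      (2 * c / (p$1)^3 * sin (p$2) - w'' (p$1) * cos (p$2))
      + (- c / (p$1)^2 * sin (p$2) - w' (p$1) * cos (p$2)) / p$1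
      + (- c / p$1 * sin (p$2) + w (p$1) * cos (p$2)) / (p$1)^2"
    unfolding \<Delta>_def laplace_beltrami_vec_def vec_lambda_beta
    by (rule laplace_beltrami_polar[OF p g,
          where \<phi> = "\<lambda>u t. c / u * sin t - w u * cos t"
            and \<phi>\<^sub>u = "\<lambda>u t. - c / u^2 * sin t - w' u * cos t"
            and \<phi>\<^sub>u\<^sub>u = "\<lambda>u t. 2 * c / u^3 * sin t - w'' u * cos t"
            and \<phi>\<^sub>t = "\<lambda>u t. c / u * cos t + w u * sin t"
            and \<phi>\<^sub>t\<^sub>t = "\<lambda>u t. - c / u * sin t + w u * cos t"])
       (auto simp: N power2_eq_square power3_eq_cube mult_ac intro!: derivative_eq_intros w1 w2)
  show "\<Delta> $ 1 = - L (p$1) * cos (p$2)"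
    unfolding \<Delta>1 using p by (simp add: L_def field_simps power2_eq_square power3_eq_cube)
  have \<Delta>2: "\<Delta> $ 2 =
      (- 2 * c / (p$1)^3 * cos (p$2) - w'' (p$1) * sin (p$2))
      + (c / (p$1)^2 * cos (p$2) - w' (p$1) * sin (p$2)) / p$1
      + (c / p$1 * cos (p$2) + w (p$1) * sin (p$2)) / (p$1)^2"
    unfolding \<Delta>_def laplace_beltrami_vec_def vec_lambda_beta
    by (rule laplace_beltrami_polar[OF p g,
          where \<phi> = "\<lambda>u t. - c / u * cos t - w u * sin t"
            and \<phi>\<^sub>u = "\<lambda>u t. c / u^2 * cos t - w' u * sin t"
            and \<phi>\<^sub>u\<^sub>u = "\<lambda>u t. - 2 * c / u^3 * cos t - w'' u * sin t"
            and \<phi>\<^sub>t = "\<lambda>u t. c / u * sin t - w u * cos t"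
            and \<phi>\<^sub>t\<^sub>t = "\<lambda>u t. c / u * cos t + w u * sin t"])
       (auto simp: N power2_eq_square power3_eq_cube mult_ac intro!: derivative_eq_intros w1 w2)
  show "\<Delta> $ 2 = - L (p$1) * sin (p$2)"
    unfolding \<Delta>2 using p by (simp add: L_def field_simps power2_eq_square power3_eq_cube)
qed

text \<open>Here the partial differential condition becomes an ordinary one. Each coordinate equation is an
  identity between trigonometric polynomials in \<open>t\<close> of the form \<open>a cos t + b sin t\<close>, so its coefficients can be read off
  at \<open>t = 0\<close> and \<open>t = \<pi>/2\<close>.\<close>

lemma coordinate_finite_type_helicoidal:
  assumes w: "\<And>u. u > 0 \<Longrightarrow> (z has_real_derivative w u) (at u)"
    and w1: "\<And>u. u > 0 \<Longrightarrow> (w has_real_derivative w' u) (at u)"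
    and w2: "\<And>u. u > 0 \<Longrightarrow> (w' has_real_derivative w'' u) (at u)"
    and eq: "\<forall>p. p$1 > 0 \<longrightarrow>
      - laplace_beltrami_vec (induced_metric (helicoidal c z)) (minimal_normal (helicoidal c z)) p
      = vector [l1 * minimal_normal (helicoidal c z) p $ 1,
                l2 * minimal_normal (helicoidal c z) p $ 2, 0]"
    and u: "u > 0"
  shows "l1 * c = 0" "l2 * c = 0"
    "w'' u + w' u / u - w u / u^2 = - l1 * w u"
    "w'' u + w' u / u - w u / u^2 = - l2 * w u"
proof -
  let ?L = "w'' u + w' u / u - w u / u^2"
  have "?L * cos t = l1 * (c / u * sin t - w u * cos t)"
       "?L * sin t = l2 * (- c / u * cos t - w u * sin t)" for t
  proof -
    let ?p = "vector [u, t] :: real^2"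
    have p: "?p $ 1 > 0" using u by simp
    from eq p have e: "- laplace_beltrami_vec (induced_metric (helicoidal c z))
          (minimal_normal (helicoidal c z)) ?p $ i
        = vector [l1 * minimal_normal (helicoidal c z) ?p $ 1,
                l2 * minimal_normal (helicoidal c z) ?p $ 2, 0] $ i" for i :: 3
      by (metis vector_uminus_component)
    show "?L * cos t = l1 * (c / u * sin t - w u * cos t)"
      using e[of 1] laplace_minimal_normal(1)[OF p w w1 w2, of c]
        minimal_normal_helicoidal[OF p w, of c] by (simp add: algebra_simps)
    show "?L * sin t = l2 * (- c / u * cos t - w u * sin t)"
      using e[of 2] laplace_minimal_normal(2)[OF p w w1 w2, of c]
        minimal_normal_helicoidal[OF p w, of c] by (simp add: algebra_simps)
  qed
  from this[of 0] this[of "pi / 2"] u show "l1 * c = 0" "l2 * c = 0" "?L = - l1 * w u" "?L = - l2 * w u"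
    by auto
qed

section \<open>Bessel's equation of order zero\<close>

text \<open>The equation \<open>y'' + y'/u + l y = 0\<close> on the positive half-line, in the self-adjoint form
  \<open>(u y')' = - l u y\<close>. The derivative \<open>y'\<close> is carried along as a separate function, so that no second
  derivative has to be mentioned and Wronskians are differentiated by the product rule alone.\<close>

definition bessel_solution :: "real \<Rightarrow> (real \<Rightarrow> real) \<Rightarrow> (real \<Rightarrow> real) \<Rightarrow> bool" where
  "bessel_solution l y y' \<longleftrightarrow> (\<forall>u>0. (y has_real_derivative y' u) (at u) \<and>
     ((\<lambda>u. u * y' u) has_real_derivative - l * u * y u) (at u))"

lemma const_on_pos_reals:
  fixes f :: "real \<Rightarrow> real"
  assumes "\<And>u. u > 0 \<Longrightarrow> (f has_real_derivative 0) (at u)"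
  shows "\<exists>k. \<forall>u>0. f u = k"
  using has_field_derivative_zero_constant[of "{0<..}" f] assms
  by (auto intro: has_field_derivative_at_within)

text \<open>Abel's identity: in the self-adjoint form the two terms \<open>\<plusminus> l u y v\<close> cancel, and so do the terms
  \<open>\<plusminus> u y' v'\<close>.\<close>

lemma bessel_wronskian_const:
  assumes "bessel_solution l y y'" "bessel_solution l v v'"
  shows "\<exists>k. \<forall>u>0. y u * (u * v' u) - v u * (u * y' u) = k"
proof (rule const_on_pos_reals)
  fix u :: real assume "u > 0"
  then have "(y has_real_derivative y' u) (at u)" "(v has_real_derivative v' u) (at u)"
    "((\<lambda>u. u * y' u) has_real_derivative - l * u * y u) (at u)"
    "((\<lambda>u. u * v' u) has_real_derivative - l * u * v u) (at u)"
    using assms by (auto simp: bessel_solution_def)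
  from DERIV_diff[OF DERIV_mult[OF this(1,4)] DERIV_mult[OF this(2,3)]]
  show "((\<lambda>u. y u * (u * v' u) - v u * (u * y' u)) has_real_derivative 0) (at u)"
    by (simp add: algebra_simps)
qed

text \<open>Uniqueness without an existence-and-uniqueness theorem. The coefficients of \<open>y\<close> with respect to \<open>f\<close> and
  \<open>g\<close> are given by Cramer's rule as the Wronskians of \<open>y\<close> with \<open>g\<close> and with \<open>f\<close>, and these are
  constants by Abel's identity.\<close>

lemma bessel_solution_span:
  assumes y: "bessel_solution l y y'" and f: "bessel_solution l f f'" and g: "bessel_solution l g g'"
    and W: "\<And>u. u > 0 \<Longrightarrow> f u * (u * g' u) - g u * (u * f' u) = 1"
  shows "\<exists>a b. \<forall>u>0. y u = a * f u + b * g u"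
proof -
  obtain a where a: "\<And>u. u > 0 \<Longrightarrow> y u * (u * g' u) - g u * (u * y' u) = a"
    using bessel_wronskian_const[OF y g] by auto
  obtain b where b: "\<And>u. u > 0 \<Longrightarrow> f u * (u * y' u) - y u * (u * f' u) = b"
    using bessel_wronskian_const[OF f y] by auto
  have "y u = a * f u + b * g u" if "u > 0" for u
  proof -
    have "a * f u + b * g u = y u * (f u * (u * g' u) - g u * (u * f' u))"
      unfolding a[OF that, symmetric] b[OF that, symmetric] by algebra
    with W[OF that] show ?thesis by simp
  qed
  then show ?thesis by blast
qed

text \<open>The power series behind all four Bessel functions. As \<open>bessel_series\<close> is a function of \<open>s = \<plusminus> x\<^sup>2/4\<close>
  (it is the hypergeometric function \<open>\<^sub>0F\<^sub>1(;1;s)\<close>), the sign that distinguishes \<open>J\<^sub>0\<close> from \<open>I\<^sub>0\<close> sits in the argument and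
  not in the coefficients. The primed versions are the derivatives.\<close>

definition bessel_coeff :: "nat \<Rightarrow> real" where
  "bessel_coeff k = 1 / (fact k)^2"

definition log_bessel_coeff :: "nat \<Rightarrow> real" where
  "log_bessel_coeff k = harm k / (fact k)^2"

definition bessel_series :: "real \<Rightarrow> real" where
  "bessel_series s = (\<Sum>k. bessel_coeff k * s ^ k)"

definition bessel_series' :: "real \<Rightarrow> real" where
  "bessel_series' s = (\<Sum>k. diffs bessel_coeff k * s ^ k)"

definition log_bessel_series :: "real \<Rightarrow> real" where
  "log_bessel_series s = (\<Sum>k. log_bessel_coeff k * s ^ k)"

definition log_bessel_series' :: "real \<Rightarrow> real" where
  "log_bessel_series' s = (\<Sum>k. diffs log_bessel_coeff k * s ^ k)"

lemma harm_le_fact: "harm k \<le> (fact k :: real)"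
proof -
  have "harm k \<le> (\<Sum>i=1..k. 1 :: real)"
    unfolding harm_def by (rule sum_mono) (auto simp: inverse_le_1_iff)
  also have "\<dots> = real k" by simp
  also have "\<dots> \<le> real (fact k)"
    by (simp only: of_nat_le_iff fact_ge_self)
  finally show ?thesis by simp
qed

lemma summable_dominated_by_exp:
  fixes c :: "nat \<Rightarrow> real"
  assumes "\<And>k. \<bar>c k\<bar> \<le> 1 / fact k"
  shows "summable (\<lambda>k. c k * s ^ k)"
proof (rule summable_comparison_test')
  show "summable (\<lambda>k. inverse (fact k) * \<bar>s\<bar> ^ k)" by (rule summable_exp)
  show "norm (c k * s ^ k) \<le> inverse (fact k) * \<bar>s\<bar> ^ k" for k
    using mult_right_mono[OF assms[of k], of "\<bar>s\<bar> ^ k"]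
    by (simp add: abs_mult power_abs divide_inverse)
qed

lemma summable_bessel_coeff: "summable (\<lambda>k. bessel_coeff k * s ^ k)"
proof (rule summable_dominated_by_exp)
  fix k
  have "1 * 1 \<le> fact k * (fact k :: real)" by (intro mult_mono fact_ge_1) auto
  then show "\<bar>bessel_coeff k\<bar> \<le> 1 / fact k"
    by (simp add: bessel_coeff_def power2_eq_square field_simps)
qed

lemma summable_log_bessel_coeff: "summable (\<lambda>k. log_bessel_coeff k * s ^ k)"
proof (rule summable_dominated_by_exp)
  fix k
  show "\<bar>log_bessel_coeff k\<bar> \<le> 1 / fact k"
    using harm_le_fact[of k] harm_nonneg[of k, where 'a=real]
    by (simp add: log_bessel_coeff_def power2_eq_square field_simps)
qed

text \<open>The operator \<open>(s f')'\<close> acts diagonally up to a shift on power series: \<open>s f'\<close> multiplies the coefficient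
  of \<open>s\<^sup>k\<close> by \<open>k\<close>, and differentiating gives a second factor. It is the leading part of Bessel's
  equation in the variable \<open>s\<close>, which thus becomes a first-order recursion for the coefficients.\<close>

lemma has_derivative_euler_powser:
  fixes c :: "nat \<Rightarrow> real"
  assumes c: "\<And>s. summable (\<lambda>k. c k * s ^ k)"
  shows "((\<lambda>s. s * (\<Sum>k. diffs c k * s ^ k)) has_real_derivative
    (\<Sum>k. (real (Suc k))^2 * c (Suc k) * s ^ k)) (at s)"
proof -
  have sd: "summable (\<lambda>k. diffs c k * x ^ k)" for x
    by (rule termdiff_converges_all) (rule c)
  have sums: "(\<lambda>k. real k * c k * x ^ k) sums (x * (\<Sum>k. diffs c k * x ^ k))" for x
  proof -
    have "(\<lambda>k. x * (real k * c k * x ^ (k - Suc 0))) sums (x * (\<Sum>k. diffs c k * x ^ k))"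
      using diffs_equiv[OF sd[of x]] by (rule sums_mult)
    moreover have "x * (real k * c k * x ^ (k - Suc 0)) = real k * c k * x ^ k" for k
      by (cases k) auto
    ultimately show ?thesis by simp
  qed
  then have euler: "(\<lambda>x. x * (\<Sum>k. diffs c k * x ^ k)) = (\<lambda>x. \<Sum>k. real k * c k * x ^ k)"
    by (simp add: sums_unique fun_eq_iff)
  have "((\<lambda>s. \<Sum>k. real k * c k * s ^ k) has_real_derivative
      (\<Sum>k. diffs (\<lambda>k. real k * c k) k * s ^ k)) (at s)"
    by (rule termdiffs_strong_converges_everywhere) (use sums sums_summable in blast)
  moreover have "diffs (\<lambda>k. real k * c k) = (\<lambda>k. (real (Suc k))^2 * c (Suc k))"
    by (simp add: diffs_def power2_eq_square mult.assoc fun_eq_iff)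
  ultimately show ?thesis
    by (simp only: euler)
qed

text \<open>The equation \<open>(s f')' = f\<close> is the recursion \<open>(k+1)\<^sup>2 a\<^sub>k\<^sub>+\<^sub>1 = a\<^sub>k\<close>.\<close>

lemma bessel_series_derivs:
  "(bessel_series has_real_derivative bessel_series' s) (at s)"
  "((\<lambda>s. s * bessel_series' s) has_real_derivative bessel_series s) (at s)"
proof -
  show "(bessel_series has_real_derivative bessel_series' s) (at s)"
    unfolding bessel_series_def[abs_def] bessel_series'_def
    by (rule termdiffs_strong_converges_everywhere) (rule summable_bessel_coeff)
  have "(real (Suc k))^2 * bessel_coeff (Suc k) = bessel_coeff k" for k
    by (simp add: bessel_coeff_def power_mult_distrib del: of_nat_Suc)
  then show "((\<lambda>s. s * bessel_series' s) has_real_derivative bessel_series s) (at s)"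
    using has_derivative_euler_powser[OF summable_bessel_coeff]
    by (simp add: bessel_series_def bessel_series'_def)
qed

text \<open>With harmonic numbers in the coefficients, \<open>H\<^sub>k\<^sub>+\<^sub>1 = H\<^sub>k + 1/(k+1)\<close> produces the additional source
  term \<open>f'\<close>. It is exactly what the logarithm in the second solution leaves over.\<close>

lemma log_bessel_series_derivs:
  "(log_bessel_series has_real_derivative log_bessel_series' s) (at s)"
  "((\<lambda>s. s * log_bessel_series' s) has_real_derivative
     log_bessel_series s + bessel_series' s) (at s)"
proof -
  show "(log_bessel_series has_real_derivative log_bessel_series' s) (at s)"
    unfolding log_bessel_series_def[abs_def] log_bessel_series'_def
    by (rule termdiffs_strong_converges_everywhere) (rule summable_log_bessel_coeff)
  have "(real (Suc k))^2 * log_bessel_coeff (Suc k) = log_bessel_coeff k + diffs bessel_coeff k" for k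
    by (simp add: log_bessel_coeff_def bessel_coeff_def diffs_def harm_Suc power_mult_distrib
        field_simps power2_eq_square del: of_nat_Suc)
  then have "(\<Sum>k. (real (Suc k))^2 * log_bessel_coeff (Suc k) * s ^ k)
      = log_bessel_series s + bessel_series' s"
    unfolding log_bessel_series_def bessel_series'_def
    by (subst suminf_add[OF summable_log_bessel_coeff termdiff_converges_all[OF summable_bessel_coeff]])
       (simp add: algebra_simps)
  then show "((\<lambda>s. s * log_bessel_series' s) has_real_derivative
     log_bessel_series s + bessel_series' s) (at s)"
    using has_derivative_euler_powser[OF summable_log_bessel_coeff, of s]
    by (simp add: log_bessel_series'_def)
qed

text \<open>The fundamental pair for \<open>(u y')' = - l u y\<close>. The scale \<open>\<kappa>\<close> inside the logarithm is left free: changing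
  it adds a multiple of the first solution to the second. The choice \<open>\<kappa> = sqrt \<bar>l\<bar> / 2\<close> gives
  \<open>Y\<^sub>0\<close> and \<open>K\<^sub>0\<close>.\<close>

definition bessel_first :: "real \<Rightarrow> real \<Rightarrow> real" where
  "bessel_first l u = bessel_series (- l * u^2 / 4)"

definition bessel_second :: "real \<Rightarrow> real \<Rightarrow> real \<Rightarrow> real" where
  "bessel_second l \<kappa> u = (ln (\<kappa> * u) + euler_mascheroni) * bessel_first l u
     - log_bessel_series (- l * u^2 / 4)"

definition bessel_first' :: "real \<Rightarrow> real \<Rightarrow> real" where
  "bessel_first' l u = bessel_series' (- l * u^2 / 4) * (- l * u / 2)"

definition bessel_second' :: "real \<Rightarrow> real \<Rightarrow> real \<Rightarrow> real" where
  "bessel_second' l \<kappa> u = bessel_first l u / u + (ln (\<kappa> * u) + euler_mascheroni) * bessel_first' l u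
     - log_bessel_series' (- l * u^2 / 4) * (- l * u / 2)"

text \<open>The chain rule carries \<open>(s f')' = f\<close> to Bessel's equation, because \<open>u d/du = 2 s d/ds\<close> for
  \<open>s = - l u\<^sup>2/4\<close>. In particular \<open>u y'\<close> is twice the function \<open>s f'(s)\<close>; this is the origin of the factor
  \<open>2\<close> in the proofs below.\<close>

lemma deriv_bessel_argument:
  "((\<lambda>u::real. - l * u^2 / 4) has_real_derivative - l * u / 2) (at u)"
  by (auto intro!: derivative_eq_intros)

lemma bessel_first_derivs:
  "(bessel_first l has_real_derivative bessel_first' l u) (at u)"
  "((\<lambda>u. u * bessel_first' l u) has_real_derivative - l * u * bessel_first l u) (at u)"
proof -
  show "(bessel_first l has_real_derivative bessel_first' l u) (at u)"
    unfolding bessel_first_def[abs_def] bessel_first'_def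
    by (rule DERIV_chain2[OF bessel_series_derivs(1) deriv_bessel_argument])
  have "((\<lambda>u. (- l * u^2 / 4) * bessel_series' (- l * u^2 / 4)) has_real_derivative
      bessel_series (- l * u^2 / 4) * (- l * u / 2)) (at u)"
    by (rule DERIV_chain2[OF bessel_series_derivs(2) deriv_bessel_argument])
  from DERIV_cmult[OF this, of 2]
  show "((\<lambda>u. u * bessel_first' l u) has_real_derivative - l * u * bessel_first l u) (at u)"
    by (simp add: bessel_first'_def bessel_first_def power2_eq_square mult_ac)
qed

lemma bessel_first_solution: "bessel_solution l (bessel_first l) (bessel_first' l)"
  by (simp only: bessel_solution_def bessel_first_derivs simp_thms)

lemma log_bessel_part_derivs:
  "((\<lambda>u. log_bessel_series (- l * u^2 / 4)) has_real_derivative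
     log_bessel_series' (- l * u^2 / 4) * (- l * u / 2)) (at u)"
  "((\<lambda>u. u * (log_bessel_series' (- l * u^2 / 4) * (- l * u / 2))) has_real_derivative
     - l * u * log_bessel_series (- l * u^2 / 4) + 2 * bessel_first' l u) (at u)"
proof -
  show "((\<lambda>u. log_bessel_series (- l * u^2 / 4)) has_real_derivative
     log_bessel_series' (- l * u^2 / 4) * (- l * u / 2)) (at u)"
    by (rule DERIV_chain2[OF log_bessel_series_derivs(1) deriv_bessel_argument])
  have "((\<lambda>u. (- l * u^2 / 4) * log_bessel_series' (- l * u^2 / 4)) has_real_derivative
      (log_bessel_series (- l * u^2 / 4) + bessel_series' (- l * u^2 / 4)) * (- l * u / 2)) (at u)"
    by (rule DERIV_chain2[OF log_bessel_series_derivs(2) deriv_bessel_argument])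
  from DERIV_cmult[OF this, of 2]
  show "((\<lambda>u. u * (log_bessel_series' (- l * u^2 / 4) * (- l * u / 2))) has_real_derivative
     - l * u * log_bessel_series (- l * u^2 / 4) + 2 * bessel_first' l u) (at u)"
    by (simp add: bessel_first'_def power2_eq_square algebra_simps)
qed

text \<open>For \<open>F\<close> the first solution and \<open>q = ln (\<kappa> u) + \<gamma>\<close>, one has \<open>u (q F)' = F + q u F'\<close>, whose derivative
  exceeds \<open>- l u q F\<close> by \<open>2 F'\<close>. The harmonic-number series has the same excess \<open>2 F'\<close>, so it cancels in the difference.\<close>

lemma bessel_second_solution:
  assumes "\<kappa> > 0"
  shows "bessel_solution l (bessel_second l \<kappa>) (bessel_second' l \<kappa>)"
  unfolding bessel_solution_def
proof (intro allI impI conjI)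
  fix u :: real assume u: "u > 0"
  note F = bessel_first_derivs[of l u] and S = log_bessel_part_derivs[of l u]
  have L: "((\<lambda>u. ln (\<kappa> * u) + euler_mascheroni) has_real_derivative 1 / u) (at u)"
    using u assms by (auto intro!: derivative_eq_intros simp: field_simps)
  show "(bessel_second l \<kappa> has_real_derivative bessel_second' l \<kappa> u) (at u)"
    unfolding bessel_second_def[abs_def]
    using DERIV_diff[OF DERIV_mult[OF L F(1)] S(1)]
    by (simp add: bessel_second'_def mult_ac add_ac)
  have "((\<lambda>u. bessel_first l u + (ln (\<kappa> * u) + euler_mascheroni) * (u * bessel_first' l u)
      - u * (log_bessel_series' (- l * u^2 / 4) * (- l * u / 2))) has_real_derivative
      - l * u * bessel_second l \<kappa> u) (at u)"
    using u by (intro DERIV_cong[OF DERIV_diff[OF DERIV_add[OF F(1) DERIV_mult[OF L F(2)]] S(2)]])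
      (simp add: bessel_second_def algebra_simps)
  then show "((\<lambda>u. u * bessel_second' l \<kappa> u) has_real_derivative - l * u * bessel_second l \<kappa> u) (at u)"
    by (rule has_field_derivative_transform_within_open[where S="{0<..}"])
       (use u in \<open>auto simp: bessel_second'_def algebra_simps\<close>)
qed

text \<open>The Wronskian is constant by Abel's identity, so its value may be computed in the limit
  \<open>u \<rightarrow> 0\<close>. The second solution is singular there, but in the Wronskian its logarithms cancel; what
  remains is a function \<open>h\<close> which is continuous at \<open>0\<close> and has the value \<open>f(0)\<^sup>2 = 1\<close>.\<close>

lemma bessel_wronskian_eq_1:
  assumes "\<kappa> > 0" "u > 0"
  shows "bessel_first l u * (u * bessel_second' l \<kappa> u) - bessel_second l \<kappa> u * (u * bessel_first' l u) = 1"
proof -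
  define h where "h = (\<lambda>u. bessel_first l u * (bessel_first l u
      - u * (log_bessel_series' (- l * u^2 / 4) * (- l * u / 2)))
      + log_bessel_series (- l * u^2 / 4) * (u * bessel_first' l u))"
  obtain k where k: "\<And>u. u > 0 \<Longrightarrow>
      bessel_first l u * (u * bessel_second' l \<kappa> u) - bessel_second l \<kappa> u * (u * bessel_first' l u) = k"
    using bessel_wronskian_const[OF bessel_first_solution bessel_second_solution] assms(1) by blast
  have hk: "h u = k" if "u > 0" for u
    unfolding k[OF that, symmetric] h_def bessel_second'_def bessel_second_def using that
    by (simp add: field_simps)
  note cont = bessel_first_derivs[THEN DERIV_isCont] log_bessel_part_derivs[THEN DERIV_isCont]
  have "isCont h 0"
    unfolding h_def
    by (rule isCont_add[OF isCont_mult[OF cont(1) isCont_diff[OF cont(1,4)]] isCont_mult[OF cont(3,2)]])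
  then have "(h \<longlongrightarrow> h 0) (at_right 0)"
    by (simp add: isCont_def filterlim_at_split)
  moreover have "(h \<longlongrightarrow> k) (at_right 0)"
    by (rule tendsto_eventually) (auto simp: hk intro: eventually_mono[OF eventually_at_right_less])
  ultimately have "k = h 0"
    using tendsto_unique[OF trivial_limit_at_right_real] by blast
  also have "h 0 = 1"
    by (simp add: h_def bessel_first_def bessel_series_def powser_zero) (simp add: bessel_coeff_def)
  finally show ?thesis using k assms(2) by simp
qed

lemma bessel_general_solution:
  assumes "bessel_solution l y y'" "\<kappa> > 0"
  shows "\<exists>a b. \<forall>u>0. y u = a * bessel_first l u + b * bessel_second l \<kappa> u"
  using bessel_solution_span[OF assms(1) bessel_first_solution bessel_second_solution]
    bessel_wronskian_eq_1 assms(2) by blast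

lemma bessel_JY_eq:
  assumes "l > 0" 
  shows "bessel_J0 (sqrt l * u) = bessel_first l u"
    and "bessel_Y0 (sqrt l * u) = 2 / pi * bessel_second l (sqrt l / 2) u"
proof -
  have "((sqrt l * u) / 2)^2 * (-1) = - l * u^2 / 4"
    using assms by (simp add: power_mult_distrib power_divide)
  then have "((sqrt l * u) / 2) ^ (2 * k) * (-1) ^ k = (- l * u^2 / 4) ^ k" for k
    by (metis power_mult power_mult_distrib)
  then have pw: "(-1) ^ k * c * ((sqrt l * u) / 2) ^ (2 * k) = c * (- l * u^2 / 4) ^ k" for k c
    by (metis mult.assoc mult.commute)
  show J: "bessel_J0 (sqrt l * u) = bessel_first l u"
    using pw[of _ 1] by (simp add: bessel_J0_def bessel_first_def bessel_series_def bessel_coeff_def)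
  show "bessel_Y0 (sqrt l * u) = 2 / pi * bessel_second l (sqrt l / 2) u"
    unfolding bessel_Y0_def J pw bessel_second_def log_bessel_series_def log_bessel_coeff_def by simp
qed

lemma bessel_IK_eq:
  assumes "l < 0" 
  shows "bessel_I0 (sqrt (- l) * u) = bessel_first l u"
    and "bessel_K0 (sqrt (- l) * u) = - bessel_second l (sqrt (- l) / 2) u"
proof -
  have pw: "((sqrt (- l) * u) / 2) ^ (2 * k) = (- l * u^2 / 4) ^ k" for k
    using assms by (simp add: power_mult power_mult_distrib power_divide)
  show I: "bessel_I0 (sqrt (- l) * u) = bessel_first l u"
    unfolding bessel_I0_def pw by (simp add: bessel_first_def bessel_series_def bessel_coeff_def)
  show "bessel_K0 (sqrt (- l) * u) = - bessel_second l (sqrt (- l) / 2) u"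
    unfolding bessel_K0_def I pw bessel_second_def log_bessel_series_def log_bessel_coeff_def
    by (simp add: algebra_simps)
qed

section \<open>Classification\<close>

lemma smooth_three_derivatives:
  assumes "smooth_real_on {0<..} z"
  obtains w w' w'' where
    "\<And>u. u > 0 \<Longrightarrow> (z has_real_derivative w u) (at u)"
    "\<And>u. u > 0 \<Longrightarrow> (w has_real_derivative w' u) (at u)"
    "\<And>u. u > 0 \<Longrightarrow> (w' has_real_derivative w'' u) (at u)"
proof
  have d: "((deriv ^^ n) z has_real_derivative (deriv ^^ Suc n) z u) (at u)" if "u > 0" for n u
    using assms that
    by (simp add: smooth_real_on_def real_differentiable_def DERIV_deriv_iff_real_differentiable)
  show "(z has_real_derivative (deriv ^^ 1) z u) (at u)" if "u > 0" for u
    using d[OF that, of 0] by simp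
  show "((deriv ^^ 1) z has_real_derivative (deriv ^^ 2) z u) (at u)" if "u > 0" for u
    using d[OF that, of 1] by (simp add: numeral_2_eq_2)
  show "((deriv ^^ 2) z has_real_derivative (deriv ^^ 3) z u) (at u)" if "u > 0" for u
    using d[OF that, of 2] by (simp add: numeral_3_eq_3 numeral_2_eq_2)
qed

text \<open>The left-hand side of the equation is \<open>(w' + w/u)'\<close>, and \<open>l w\<close> is the derivative of \<open>l z\<close>.\<close>

lemma profile_first_integral:
  assumes w: "\<And>u. u > 0 \<Longrightarrow> (z has_real_derivative w u) (at u)"
    and w1: "\<And>u. u > 0 \<Longrightarrow> (w has_real_derivative w' u) (at u)"
    and w2: "\<And>u. u > 0 \<Longrightarrow> (w' has_real_derivative w'' u) (at u)"
    and eq: "\<And>u. u > 0 \<Longrightarrow> w'' u + w' u / u - w u / u^2 = - l * w u"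
  shows "\<exists>k. \<forall>u>0. w' u + w u / u + l * z u = k"
proof (rule const_on_pos_reals)
  fix u :: real assume u: "u > 0"
  show "((\<lambda>u. w' u + w u / u + l * z u) has_real_derivative 0) (at u)"
  proof (rule DERIV_cong[OF DERIV_add[OF DERIV_add[OF w2 DERIV_divide[OF w1 DERIV_ident]]
          DERIV_cmult[OF w]]])
    have "(w' u * u - w u * 1) / (u * u) = w' u / u - w u / u^2"
      using u by (simp add: field_simps power2_eq_square)
    with eq[OF u] show "w'' u + (w' u * u - w u * 1) / (u * u) + l * w u = 0" by simp
  qed (use u in auto)
qed

text \<open>Multiplied by \<open>u\<close>, the equation is \<open>(u w)' = k u\<close>; hence \<open>w = k u/2 + b/u\<close>, and \<open>z\<close> is an
  antiderivative.\<close>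

lemma profile_of_zero_eigenvalue:
  assumes w: "\<And>u. u > 0 \<Longrightarrow> (z has_real_derivative w u) (at u)"
    and w1: "\<And>u. u > 0 \<Longrightarrow> (w has_real_derivative w' u) (at u)"
    and k: "\<And>u. u > 0 \<Longrightarrow> w' u + w u / u = k"
  shows "\<exists>z0 z1 z2. \<forall>u>0. z u = z0 + z1 * u^2 + z2 * ln u"
proof -
  have "\<exists>b. \<forall>u>0. u * w u - k * u^2 / 2 = b"
  proof (rule const_on_pos_reals)
    fix u :: real assume u: "u > 0"
    show "((\<lambda>u. u * w u - k * u^2 / 2) has_real_derivative 0) (at u)"
      by (rule derivative_eq_intros w1 u refl)+ (use u k[OF u] in \<open>auto simp: field_simps\<close>)
  qed
  then obtain b where b: "\<And>u. u > 0 \<Longrightarrow> u * w u - k * u^2 / 2 = b" by blast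
  have "\<exists>d. \<forall>u>0. z u - k / 4 * u^2 - b * ln u = d"
  proof (rule const_on_pos_reals)
    fix u :: real assume u: "u > 0"
    show "((\<lambda>u. z u - k / 4 * u^2 - b * ln u) has_real_derivative 0) (at u)"
      by (rule derivative_eq_intros w u refl)+
         (use u b[OF u] in \<open>auto simp: field_simps power2_eq_square\<close>)
  qed
  then obtain d where "\<And>u. u > 0 \<Longrightarrow> z u - k / 4 * u^2 - b * ln u = d" by blast
  then have "\<forall>u>0. z u = d + k / 4 * u^2 + b * ln u" by (simp add: algebra_simps)
  then show ?thesis by blast
qed

text \<open>Subtracting the particular solution \<open>k/l\<close> leaves the homogeneous Bessel equation. The factors
  \<open>2/\<pi>\<close> of \<open>Y\<^sub>0\<close> and \<open>-1\<close> of \<open>K\<^sub>0\<close> are absorbed into the constants.\<close>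

lemma profile_of_nonzero_eigenvalue:
  assumes w: "\<And>u. u > 0 \<Longrightarrow> (z has_real_derivative w u) (at u)"
    and w1: "\<And>u. u > 0 \<Longrightarrow> (w has_real_derivative w' u) (at u)"
    and k: "\<And>u. u > 0 \<Longrightarrow> w' u + w u / u + l * z u = k"
    and l: "l \<noteq> 0"
  shows "\<exists>z0 z1 z2. \<forall>u>0. z u =
    (if l > 0
     then z0 + z1 * bessel_J0 (sqrt l * u) + z2 * bessel_Y0 (sqrt l * u)
     else z0 + z1 * bessel_I0 (sqrt (- l) * u) + z2 * bessel_K0 (sqrt (- l) * u))"
proof -
  have "bessel_solution l (\<lambda>u. z u - k / l) w"
    unfolding bessel_solution_def
  proof (intro allI impI conjI)
    fix u :: real assume u: "u > 0"
    show "((\<lambda>u. z u - k / l) has_real_derivative w u) (at u)"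
      by (rule derivative_eq_intros w u refl)+ simp
    show "((\<lambda>u. u * w u) has_real_derivative - l * u * (z u - k / l)) (at u)"
      by (rule derivative_eq_intros w1 u refl)+
         (use u l k[OF u, symmetric] in \<open>simp add: field_simps\<close>)
  qed
  moreover have "sqrt \<bar>l\<bar> / 2 > 0" using l by simp
  ultimately obtain a b where
    "\<And>u. u > 0 \<Longrightarrow> z u - k / l = a * bessel_first l u + b * bessel_second l (sqrt \<bar>l\<bar> / 2) u"
    using bessel_general_solution by blast
  then have ab: "z u = k / l + a * bessel_first l u + b * bessel_second l (sqrt \<bar>l\<bar> / 2) u" if "u > 0" for u
    using that by (simp add: diff_eq_eq)
  show ?thesis
  proof (cases "l > 0")
    case True
    then have "\<forall>u>0. z u = k / l + a * bessel_J0 (sqrt l * u) + (b * pi / 2) * bessel_Y0 (sqrt l * u)"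
      using ab by (simp add: bessel_JY_eq)
    with True show ?thesis by (simp only: if_True) blast
  next
    case False
    then have "\<forall>u>0. z u = k / l + a * bessel_I0 (sqrt (- l) * u) + (- b) * bessel_K0 (sqrt (- l) * u)"
      using ab l by (simp add: bessel_IK_eq)
    with False show ?thesis by (simp only: if_False) blast
  qed
qed

theorem theorem4p1:
  fixes c l1 l2 :: real and z :: "real \<Rightarrow> real"
  assumes "smooth_real_on {0<..} z"
    and "\<forall>p. p$1 > 0 \<longrightarrow>
      - laplace_beltrami_vec (induced_metric (helicoidal c z)) (minimal_normal (helicoidal c z)) p
      = vector [l1 * minimal_normal (helicoidal c z) p $ 1,
                l2 * minimal_normal (helicoidal c z) p $ 2, 0]"
  shows "(c \<noteq> 0 \<longrightarrow> l1 = 0 \<and> l2 = 0 \<and>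
            (\<exists>z0 z1 z2. \<forall>u>0. z u = z0 + z1 * u^2 + z2 * ln u)) \<and>
         (c = 0 \<longrightarrow>
            (l1 = 0 \<and> l2 = 0 \<longrightarrow>
               (\<exists>z0 z1 z2. \<forall>u>0. z u = z0 + z1 * u^2 + z2 * ln u)) \<and>
            (\<forall>l. l1 = l \<and> l2 = l \<and> l \<noteq> 0 \<longrightarrow>
               (\<exists>z0 z1 z2. \<forall>u>0. z u =
                  (if l > 0
                   then z0 + z1 * bessel_J0 (sqrt l * u) + z2 * bessel_Y0 (sqrt l * u)
                   else z0 + z1 * bessel_I0 (sqrt (- l) * u) + z2 * bessel_K0 (sqrt (- l) * u)))) \<and>
            (l1 \<noteq> l2 \<longrightarrow> (\<exists>z0. \<forall>u>0. z u = z0)))"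
proof -
  obtain w w' w'' where w: "\<And>u. u > 0 \<Longrightarrow> (z has_real_derivative w u) (at u)"
    and w1: "\<And>u. u > 0 \<Longrightarrow> (w has_real_derivative w' u) (at u)"
    and w2: "\<And>u. u > 0 \<Longrightarrow> (w' has_real_derivative w'' u) (at u)"
    using smooth_three_derivatives[OF assms(1)] by blast
  have *: "l1 * c = 0" "l2 * c = 0"
    "w'' u + w' u / u - w u / u^2 = - l1 * w u"
    "w'' u + w' u / u - w u / u^2 = - l2 * w u" if "u > 0" for u
    using coordinate_finite_type_helicoidal[OF w w1 w2 assms(2) that] by blast+
  have c: "l1 * c = 0" "l2 * c = 0" using *(1,2)[of 1] by auto
  obtain k where k: "\<And>u. u > 0 \<Longrightarrow> w' u + w u / u + l1 * z u = k"
    using profile_first_integral[OF w w1 w2 *(3)] by blast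
  have zero: "\<exists>z0 z1 z2. \<forall>u>0. z u = z0 + z1 * u^2 + z2 * ln u" if "l1 = 0"
    using profile_of_zero_eigenvalue[OF w w1] k that by simp
  have const: "\<exists>z0. \<forall>u>0. z u = z0" if "l1 \<noteq> l2"
  proof (rule const_on_pos_reals)
    fix u :: real assume u: "u > 0"
    from *(3,4)[OF u] that have "w u = 0" by simp
    with w[OF u] show "(z has_real_derivative 0) (at u)" by simp
  qed
  show ?thesis
    using c zero const profile_of_nonzero_eigenvalue[OF w w1 k] by auto
qed

end
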